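(* Let $G$ be a connected graph of order $n\ge 2$ with vertex set $\{v_1,\ldots,v_n\}$ and $d_{i,j}=d(v_i,v_j)$. For $i=1,\ldots,n$ let $p_i=\max_{j\neq i}d_{i,j}$, let $\mathbf{p}=[p_1,\ldots,p_n]^T$, and let $\mathcal{B}(G)=\mathcal{L}(G)+\mathbf{1}\mathbf{p}^T$, where $\mathbf{1}$ is the all-ones column vector. Then $$\partial_1^{L}(G)\le \sum_{i=1}^{n}p_i .$$ If equality holds, then $\mathcal{B}(G)$ is a reducible matrix. This necessary condition for equality is not sufficient: there exists a connected graph $G$ for which $\mathcal{B}(G)$ is reducible but $\partial_1^{L}(G)<\sum_{i=1}^n p_i$. If $\mathcal{B}(G)$ is an irreducible matrix, then the inequality is strict.
   Context: Graphs are finite, simple and undirected. For a connected graph $G$ with vertices $v_1,\ldots,v_n$, $d(u,v)$ is the length of a shortest path between $u$ and $v$; the distance matrix is $\mathcal{D}(G)=(d_{i,j})$ with $d_{i,j}=d(v_i,v_j)$; the transmission of a vertex is $Tr(v)=\sum_{u\in V(G)}d(v,u)$; $Tr(G)=\mathrm{diag}[Tr(v_1),\ldots,Tr(v_n)]$. The distance Laplacian matrix is $\mathcal{L}(G)=Tr(G)-\mathcal{D}(G)$, with eigenvalues $\partial_1^{L}(G)\ge\cdots\ge\partial_n^{L}(G)$. A square matrix $A=(a_{i,j})$ of order $n\ge 2$ is reducible if there is a nonempty proper subset $S\subset\{1,\ldots,n\}$ with $a_{i,j}=0$ for all $i\in S$, $j\notin S$; otherwise it is irreducible. *)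

theory Defs
  imports
    "Graph_Theory.Digraph_Component"
    "Jordan_Normal_Form.Char_Poly"
begin

text \<open>
  A finite simple undirected graph is a \<^locale>\<open>pair_graph\<close>: finitely many vertices and arcs,
  no loops, at most one arc from u to v, and (u, v) is an arc iff (v, u) is.
  The labelling of the vertices is a list \<open>vs\<close> with \<open>distinct vs\<close> and \<open>set vs = pverts G\<close>,
  so that the vertex with index \<open>i + 1\<close> is \<open>vs ! i\<close>; matrix indices range over \<open>{0..<n}\<close>.
\<close>

text \<open>The length of a shortest path; only meaningful if v is reachable from u.\<close>

definition graph_dist :: "'a pair_pre_digraph \<Rightarrow> 'a \<Rightarrow> 'a \<Rightarrow> nat" where
  "graph_dist G u v = (LEAST k. \<exists>p. pre_digraph.apath (with_proj G) u p v \<and> length p = k)"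

definition transmission :: "'a pair_pre_digraph \<Rightarrow> 'a \<Rightarrow> nat" where
  "transmission G v = (\<Sum>u\<in>pverts G. graph_dist G v u)"

definition distance_matrix :: "'a pair_pre_digraph \<Rightarrow> 'a list \<Rightarrow> real mat" where
  "distance_matrix G vs =
     mat (length vs) (length vs) (\<lambda>(i, j). real (graph_dist G (vs ! i) (vs ! j)))"

definition transmission_matrix :: "'a pair_pre_digraph \<Rightarrow> 'a list \<Rightarrow> real mat" where
  "transmission_matrix G vs = mat_diag (length vs) (\<lambda>i. real (transmission G (vs ! i)))"

definition distance_laplacian :: "'a pair_pre_digraph \<Rightarrow> 'a list \<Rightarrow> real mat" where
  "distance_laplacian G vs = transmission_matrix G vs - distance_matrix G vs"

text \<open>
  The eigenvalues, with algebraic multiplicity, in non-increasing order. Nothing is lost by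
  taking only the real roots, since the distance Laplacian of a graph is a symmetric real matrix.
\<close>

definition dl_eigenvalues :: "'a pair_pre_digraph \<Rightarrow> 'a list \<Rightarrow> real list" where
  "dl_eigenvalues G vs =
     rev (sorted_list_of_multiset (proots (char_poly (distance_laplacian G vs))))"

text \<open>The \<open>i\<close>-th largest eigenvalue, where \<open>i\<close> counts from 1.\<close>

definition dl_eigenvalue :: "'a pair_pre_digraph \<Rightarrow> 'a list \<Rightarrow> nat \<Rightarrow> real" where
  "dl_eigenvalue G vs i = dl_eigenvalues G vs ! (i - 1)"

definition max_dist :: "'a pair_pre_digraph \<Rightarrow> 'a list \<Rightarrow> nat \<Rightarrow> nat" where
  "max_dist G vs i = Max {graph_dist G (vs ! i) (vs ! j) | j. j < length vs \<and> j \<noteq> i}"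

definition max_dist_vec :: "'a pair_pre_digraph \<Rightarrow> 'a list \<Rightarrow> real vec" where
  "max_dist_vec G vs = vec (length vs) (\<lambda>i. real (max_dist G vs i))"

definition all_ones_vec :: "nat \<Rightarrow> real vec" where
  "all_ones_vec n = vec n (\<lambda>_. 1)"

text \<open>The second summand is the product of an n x 1 matrix with a 1 x n matrix.\<close>

definition B_matrix :: "'a pair_pre_digraph \<Rightarrow> 'a list \<Rightarrow> real mat" where
  "B_matrix G vs =
     distance_laplacian G vs +
     mat_of_cols (length vs) [all_ones_vec (length vs)] *
     mat_of_rows (length vs) [max_dist_vec G vs]"

definition reducible_mat :: "'a :: zero mat \<Rightarrow> bool" where
  "reducible_mat A \<longleftrightarrow> square_mat A \<and> dim_row A \<ge> 2 \<and>
     (\<exists>S. S \<noteq> {} \<and> S \<subset> {0..<dim_row A} \<and>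
       (\<forall>i\<in>S. \<forall>j\<in>{0..<dim_row A} - S. A $$ (i, j) = 0))"

definition irreducible_mat :: "'a :: zero mat \<Rightarrow> bool" where
  "irreducible_mat A \<longleftrightarrow> square_mat A \<and> dim_row A \<ge> 2 \<and> \<not> reducible_mat A"

definition connected_labelled_graph :: "'a pair_pre_digraph \<Rightarrow> 'a list \<Rightarrow> bool" where
  "connected_labelled_graph G vs \<longleftrightarrow>
     pair_graph G \<and> Digraph_Component.connected (with_proj G) \<and>
     distinct vs \<and> set vs = pverts G"

end

theory Submission
  imports Defs
begin

text \<open>
  Write \<open>L\<close> for the distance Laplacian, \<open>p\<close> for the vector of eccentricities \<open>max_dist\<close>, \<open>P\<close> for
  the sum of its entries and \<open>B\<close> for the matrix \<open>L\<close> with \<open>p\<close> added to every row. Two features make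
  \<open>B\<close> useful. Its entries are nonnegative, because off the diagonal \<open>L\<close> has the entry \<open>-d(i, j)\<close>, a
  distance from \<open>j\<close> that \<open>p j\<close> dominates, and on it \<open>L\<close> has a transmission; and its rows all sum to \<open>P\<close>, because those of \<open>L\<close> sum to
  0. At the same time, adding a fixed row to every row of \<open>L\<close> does not disturb its nonzero spectrum:
  a left eigenvector \<open>x\<close> of \<open>L\<close> for \<open>k \<noteq> 0\<close> has entries summing to 0, since \<open>L\<close> kills the all-ones
  vector, so \<open>x\<close> is a left eigenvector of \<open>B\<close> for the same \<open>k\<close>
  (\<open>nonzero_eigenvalue_le_sum_of_shift\<close>).

  It remains to bound an eigenvalue of a nonnegative matrix by its constant row sum and to see what
  equality forces (\<open>left_eigenvector_positive_part\<close>). The positive part \<open>y\<close> of \<open>x\<close> satisfies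
  \<open>k y \<le> y B\<close> entrywise, and summing the entries gives \<open>k \<le> P\<close>. If \<open>k = P\<close>, every entry must be an
  equality, so \<open>B\<close> has only zeros in the rows where \<open>x\<close> is positive and the columns where it is not.
  Thus \<open>B\<close> is reducible. The argument applies to \<open>-x\<close> as well, so equality even forces two
  \<^emph>\<open>disjoint\<close> sets witnessing reducibility.

  This stronger conclusion also settles the counterexample without computing any eigenvalue. In the
  wheel, a hub joined to all vertices of a 4-cycle, the rim is a witness of reducibility because
  every rim vertex is at the maximal distance 1 from the hub. But every witness contains the whole
  rim, in particular the vertex 1 (\<open>wheel_zero_block_rim\<close>), so no two witnesses are disjoint and
  equality fails.
\<close>

section \<open>Left eigenvectors of nonnegative matrices\<close>

text \<open>
  A witness of reducibility, or the whole index set. Equality produces two disjoint zero blocks, and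
  each of them is then a proper subset because the other one is not empty.
\<close>

definition zero_block :: "'a :: zero mat \<Rightarrow> nat set \<Rightarrow> bool" where
  "zero_block A S \<longleftrightarrow> S \<noteq> {} \<and> S \<subseteq> {0..<dim_row A} \<and>
     (\<forall>i\<in>S. \<forall>j\<in>{0..<dim_row A} - S. A $$ (i, j) = 0)"

text \<open>
  For the positive part \<open>y\<close> of \<open>x\<close>, the entry of \<open>y B\<close> at \<open>j\<close> is at least that of \<open>x B\<close>, which is
  \<open>k x j\<close>, and it is at least 0; hence \<open>k y \<le> y B\<close> entrywise. The entries of \<open>y B\<close> sum to \<open>r\<close> times
  the positive sum of those of \<open>y\<close>, which yields the bound. When \<open>k = r\<close> the sums of both sides agree,
  so \<open>y B\<close> vanishes wherever \<open>y\<close> does, and it is there a sum of nonnegative terms \<open>y i * B i j\<close>.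
\<close>

lemma left_eigenvector_positive_part:
  fixes B :: "'i \<Rightarrow> 'i \<Rightarrow> real"
  assumes fin: "finite I"
    and nonneg: "\<And>i j. i \<in> I \<Longrightarrow> j \<in> I \<Longrightarrow> B i j \<ge> 0"
    and row: "\<And>i. i \<in> I \<Longrightarrow> (\<Sum>j\<in>I. B i j) = r"
    and eig: "\<And>j. j \<in> I \<Longrightarrow> (\<Sum>i\<in>I. x i * B i j) = k * x j"
    and pos: "m \<in> I" "x m > 0"
  shows "k \<le> r"
    and "k = r \<Longrightarrow> i \<in> I \<Longrightarrow> j \<in> I \<Longrightarrow> x i > 0 \<Longrightarrow> x j \<le> 0 \<Longrightarrow> B i j = 0"
proof -
  define y where "y i = max 0 (x i)" for i
  have y0: "y i \<ge> 0" for i by (simp add: y_def)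
  have total: "(\<Sum>j\<in>I. \<Sum>i\<in>I. y i * B i j) = r * sum y I"
  proof -
    have "(\<Sum>j\<in>I. \<Sum>i\<in>I. y i * B i j) = (\<Sum>i\<in>I. \<Sum>j\<in>I. y i * B i j)"
      by (rule sum.swap)
    also have "\<dots> = (\<Sum>i\<in>I. y i * r)"
      by (intro sum.cong refl) (simp add: sum_distrib_left[symmetric] row)
    finally show ?thesis by (simp add: sum_distrib_left mult.commute)
  qed
  have column: "k * y j \<le> (\<Sum>i\<in>I. y i * B i j)" if j: "j \<in> I" for j
  proof (cases "x j > 0")
    case True
    have "k * y j = (\<Sum>i\<in>I. x i * B i j)" using True eig[OF j] by (simp add: y_def)
    also have "\<dots> \<le> (\<Sum>i\<in>I. y i * B i j)"
      by (intro sum_mono mult_right_mono nonneg j) (auto simp: y_def)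
    finally show ?thesis .
  next
    case False
    have "0 \<le> (\<Sum>i\<in>I. y i * B i j)" by (intro sum_nonneg mult_nonneg_nonneg y0 nonneg j)
    then show ?thesis using False by (simp add: y_def)
  qed
  have "0 < y m" using pos by (simp add: y_def)
  also have "y m \<le> sum y I" by (intro member_le_sum pos fin y0)
  finally have ypos: "sum y I > 0" .
  have "k * sum y I \<le> (\<Sum>j\<in>I. \<Sum>i\<in>I. y i * B i j)"
    unfolding sum_distrib_left by (intro sum_mono column)
  also note total
  finally have "k * sum y I \<le> r * sum y I" .
  with ypos show "k \<le> r" by simp
  assume eq: "k = r" and i: "i \<in> I" and j: "j \<in> I" and xi: "x i > 0" and xj: "x j \<le> 0"
  have "(\<Sum>j\<in>I. (\<Sum>i\<in>I. y i * B i j) - k * y j) = 0"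
    by (simp add: sum_subtractf total eq sum_distrib_left)
  then have "(\<Sum>i\<in>I. y i * B i j) - k * y j = 0"
    using sum_nonneg_eq_0_iff[OF fin, of "\<lambda>j. (\<Sum>i\<in>I. y i * B i j) - k * y j"] column j by auto
  then have "(\<Sum>i\<in>I. y i * B i j) = 0" using xj by (simp add: y_def)
  then have "y i * B i j = 0"
    using sum_nonneg_eq_0_iff[OF fin, of "\<lambda>i. y i * B i j"] y0 nonneg i j by auto
  then show "B i j = 0" using xi by (simp add: y_def)
qed

text \<open>
  The link between the spectrum of \<open>L\<close> and the nonnegative matrix \<open>B\<close>: the entries of a left
  eigenvector of \<open>L\<close> for \<open>k \<noteq> 0\<close> sum to 0. Hence it is also a left eigenvector of \<open>B\<close>, and it has both
  positive and negative entries, whose index sets are the two sets in the conclusion.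
\<close>

lemma nonzero_eigenvalue_le_sum_of_shift:
  fixes L B :: "real mat" and p :: "nat \<Rightarrow> real"
  assumes L: "L \<in> carrier_mat n n" and B: "B \<in> carrier_mat n n"
    and row: "\<And>i. i < n \<Longrightarrow> (\<Sum>j<n. L $$ (i, j)) = 0"
    and shift: "\<And>i j. i < n \<Longrightarrow> j < n \<Longrightarrow> B $$ (i, j) = L $$ (i, j) + p j"
    and nonneg: "\<And>i j. i < n \<Longrightarrow> j < n \<Longrightarrow> B $$ (i, j) \<ge> 0"
    and ev: "eigenvalue L k" and k: "k \<noteq> 0"
  shows "k \<le> (\<Sum>j<n. p j)"
    and "k = (\<Sum>j<n. p j) \<Longrightarrow> \<exists>S T. zero_block B S \<and> zero_block B T \<and> S \<inter> T = {}"
proof -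
  \<comment> \<open>Transposing turns eigenvectors into the left eigenvectors that the argument needs.\<close>
  have LT: "transpose_mat L \<in> carrier_mat n n" using L by simp
  have "eigenvalue (transpose_mat L) k"
    using ev unfolding eigenvalue_root_char_poly[OF L] eigenvalue_root_char_poly[OF LT]
    by (simp add: char_poly_transpose_mat[OF L])
  then obtain v where v: "v \<in> carrier_vec n" "v \<noteq> 0\<^sub>v n" "transpose_mat L *\<^sub>v v = k \<cdot>\<^sub>v v"
    using L by (auto simp: eigenvalue_def eigenvector_def)
  define x where "x i = v $ i" for i
  have eigL: "(\<Sum>i<n. x i * L $$ (i, j)) = k * x j" if "j < n" for j
  proof -
    have "(transpose_mat L *\<^sub>v v) $ j = k * x j" using v that by (simp add: x_def)
    moreover have "(transpose_mat L *\<^sub>v v) $ j = (\<Sum>i<n. x i * L $$ (i, j))"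
      using L v(1) that
      by (auto simp: scalar_prod_def x_def lessThan_atLeast0 mult.commute intro!: sum.cong)
    ultimately show ?thesis by simp
  qed
  have "k * (\<Sum>j<n. x j) = (\<Sum>j<n. \<Sum>i<n. x i * L $$ (i, j))"
    by (simp add: eigL sum_distrib_left)
  also have "\<dots> = (\<Sum>i<n. \<Sum>j<n. x i * L $$ (i, j))" by (rule sum.swap)
  also have "\<dots> = 0" by (simp add: sum_distrib_left[symmetric] row)
  finally have sum0: "(\<Sum>j<n. x j) = 0" using k by simp
  have eigB: "(\<Sum>i\<in>{..<n}. x i * B $$ (i, j)) = k * x j" if "j \<in> {..<n}" for j
  proof -
    have "(\<Sum>i<n. x i * B $$ (i, j)) = (\<Sum>i<n. x i * L $$ (i, j)) + (\<Sum>i<n. x i) * p j"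
      using that by (simp add: shift algebra_simps sum.distrib sum_distrib_left)
    then show ?thesis using that eigL sum0 by simp
  qed
  have eigB': "(\<Sum>i\<in>{..<n}. - x i * B $$ (i, j)) = k * - x j" if "j \<in> {..<n}" for j
    using eigB[OF that] by (simp add: sum_negf)
  have rowB: "(\<Sum>j\<in>{..<n}. B $$ (i, j)) = (\<Sum>j<n. p j)" if "i \<in> {..<n}" for i
    using that row by (simp add: shift sum.distrib)
  have nonnegB: "B $$ (i, j) \<ge> 0" if "i \<in> {..<n}" "j \<in> {..<n}" for i j
    using that nonneg by simp
  obtain a where a: "a < n" "x a \<noteq> 0"
    using v by (metis carrier_vecD eq_vecI index_zero_vec x_def)
  have pos: "\<exists>i\<in>{..<n}. x i > 0"
  proof (rule ccontr)
    assume "\<not> ?thesis"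
    then have "\<forall>i\<in>{..<n}. - x i \<ge> 0" by force
    with sum0 a sum_nonneg_eq_0_iff[of "{..<n}" "\<lambda>i. - x i"] show False
      by (auto simp: sum_negf)
  qed
  have neg: "\<exists>i\<in>{..<n}. - x i > 0"
  proof (rule ccontr)
    assume "\<not> ?thesis"
    then have "\<forall>i\<in>{..<n}. x i \<ge> 0" by force
    with sum0 a sum_nonneg_eq_0_iff[of "{..<n}" x] show False by auto
  qed
  from pos obtain b where b: "b \<in> {..<n}" "x b > 0" by blast
  from neg obtain c where c: "c \<in> {..<n}" "- x c > 0" by blast
  note plus = left_eigenvector_positive_part
    [where I = "{..<n}" and B = "\<lambda>i j. B $$ (i, j)" and x = x, OF _ nonnegB rowB eigB b]
  note minus = left_eigenvector_positive_part
    [where I = "{..<n}" and B = "\<lambda>i j. B $$ (i, j)" and x = "\<lambda>i. - x i", OF _ nonnegB rowB eigB' c]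
  show "k \<le> (\<Sum>j<n. p j)" by (rule plus(1)) auto
  assume eq: "k = (\<Sum>j<n. p j)"
  have "zero_block B {i. i < n \<and> x i > 0}"
    unfolding zero_block_def using B b by (auto intro!: plus(2)[OF _ _ _ _ _ eq])
  moreover have "zero_block B {i. i < n \<and> - x i > 0}"
    unfolding zero_block_def using B c by (auto intro!: minus(2)[OF _ _ _ _ _ eq])
  ultimately show "\<exists>S T. zero_block B S \<and> zero_block B T \<and> S \<inter> T = {}"
    by (intro exI[of _ "{i. i < n \<and> x i > 0}"] exI[of _ "{i. i < n \<and> - x i > 0}"]) auto
qed

section \<open>Distances in a connected graph\<close>

lemma graph_dist_commute:
  assumes "pair_graph G"
  shows "graph_dist G u v = graph_dist G v u"
proof -
  interpret pair_graph G by fact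
  have "(\<exists>p. apath u p v \<and> length p = k) \<longleftrightarrow> (\<exists>p. apath v p u \<and> length p = k)" for k
  proof -
    have "\<exists>q. apath b q a \<and> length q = k" if "apath a p b" "length p = k" for a b p
    proof
      have "length (rev_path p) = length p" by (induct p) auto
      then show "apath b (rev_path p) a \<and> length (rev_path p) = k" using that by simp
    qed
    then show ?thesis by blast
  qed
  then show ?thesis by (simp add: graph_dist_def)
qed

text \<open>
  A minimum over the lengths of paths is only meaningful once a path exists, which is where
  connectedness enters.
\<close>

lemma graph_dist_attained:
  assumes "pair_graph G" "Digraph_Component.connected (with_proj G)"
    and "u \<in> pverts G" "v \<in> pverts G"
  shows "\<exists>p. pre_digraph.apath (with_proj G) u p v \<and> length p = graph_dist G u v"
proof -
  interpret pair_graph G by fact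
  have "strongly_connected (with_proj G)"
    by (rule symmetric_connected_imp_strongly_connected[OF pair_sym_arcs assms(2)])
  then have "u \<rightarrow>\<^sup>*\<^bsub>with_proj G\<^esub> v"
    using assms(3,4) by (simp add: strongly_connected_def)
  then obtain p where "apath u p v"
    unfolding reachable_apath by blast
  then show ?thesis
    unfolding graph_dist_def by (rule_tac LeastI_ex) blast
qed

lemma graph_dist_pos:
  assumes "pair_graph G" "Digraph_Component.connected (with_proj G)"
    and "u \<in> pverts G" "v \<in> pverts G" "u \<noteq> v"
  shows "graph_dist G u v > 0"
proof -
  interpret pair_graph G by fact
  obtain p where "apath u p v" "length p = graph_dist G u v"
    using graph_dist_attained[OF assms(1-4)] by auto
  then show ?thesis using assms(5) by (cases p) (auto simp: apath_Nil_iff)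
qed

lemma graph_dist_eq_1_iff:
  assumes "pair_graph G" "Digraph_Component.connected (with_proj G)"
    and "u \<in> pverts G" "v \<in> pverts G" "u \<noteq> v"
  shows "graph_dist G u v = 1 \<longleftrightarrow> (u, v) \<in> parcs G"
proof -
  interpret pair_graph G by fact
  show ?thesis
  proof
    assume "graph_dist G u v = 1"
    then obtain p where p: "apath u p v" "length p = 1"
      using graph_dist_attained[OF assms(1-4)] by auto
    then obtain e where "p = [e]" by (auto simp: length_Suc_conv)
    with p(1) show "(u, v) \<in> parcs G"
      by (cases e) (auto simp: apath_Cons_iff apath_Nil_iff)
  next
    assume arc: "(u, v) \<in> parcs G"
    have "apath u [(u, v)] v" using arc assms(3-5) by (simp add: apath_Cons_iff apath_Nil_iff)
    then have "graph_dist G u v \<le> 1"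
      unfolding graph_dist_def by (intro Least_le exI[of _ "[(u, v)]"]) simp
    then show "graph_dist G u v = 1" using graph_dist_pos[OF assms] by linarith
  qed
qed

lemma graph_dist_le_max_dist:
  assumes "i < length vs" "j < length vs" "i \<noteq> j"
  shows "graph_dist G (vs ! i) (vs ! j) \<le> max_dist G vs i"
proof -
  have "{graph_dist G (vs ! i) (vs ! j) | j. j < length vs \<and> j \<noteq> i} =
      (\<lambda>j. graph_dist G (vs ! i) (vs ! j)) ` ({..<length vs} - {i})"
    by auto
  then show ?thesis unfolding max_dist_def using assms by simp
qed

lemma max_dist_pos:
  assumes G: "connected_labelled_graph G vs" and n: "length vs \<ge> 2" and i: "i < length vs"
  shows "max_dist G vs i > 0"
proof -
  obtain j where j: "j < length vs" "j \<noteq> i"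
    using n by (intro that[of "if i = 0 then 1 else 0"]) auto
  have conn: "pair_graph G" "Digraph_Component.connected (with_proj G)"
    and vs: "distinct vs" "set vs = pverts G"
    using G by (simp_all add: connected_labelled_graph_def)
  have "vs ! i \<noteq> vs ! j" using vs(1) i j by (simp add: nth_eq_iff_index_eq)
  then have "graph_dist G (vs ! i) (vs ! j) > 0"
    using i j vs(2) nth_mem by (intro graph_dist_pos[OF conn]) auto
  then show ?thesis using graph_dist_le_max_dist[OF i j(1), of G] j(2) by linarith
qed

section \<open>The distance Laplacian and its shift\<close>

lemma distance_laplacian_carrier:
  "distance_laplacian G vs \<in> carrier_mat (length vs) (length vs)"
  by (auto simp: distance_laplacian_def distance_matrix_def)

lemma distance_laplacian_index:
  assumes "i < length vs" "j < length vs"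
  shows "distance_laplacian G vs $$ (i, j) =
    (if i = j then real (transmission G (vs ! i)) else 0) - real (graph_dist G (vs ! i) (vs ! j))"
  using assms
  by (auto simp: distance_laplacian_def distance_matrix_def transmission_matrix_def mat_diag_def)

lemma transmission_conv_sum_nth:
  assumes "distinct vs" "set vs = pverts G"
  shows "transmission G v = (\<Sum>j<length vs. graph_dist G v (vs ! j))"
proof -
  have "transmission G v = sum_list (map (graph_dist G v) vs)"
    using assms by (simp add: transmission_def sum_list_distinct_conv_sum_set)
  then show ?thesis by (simp add: sum_list_sum_nth lessThan_atLeast0)
qed

lemma distance_laplacian_row_sum:
  assumes "distinct vs" "set vs = pverts G" "i < length vs"
  shows "(\<Sum>j<length vs. distance_laplacian G vs $$ (i, j)) = 0"
  using assms(3)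
  by (simp add: distance_laplacian_index sum_subtractf transmission_conv_sum_nth[OF assms(1,2)])

lemma B_matrix_carrier:
  "B_matrix G vs \<in> carrier_mat (length vs) (length vs)"
  unfolding B_matrix_def by (auto intro!: add_carrier_mat)

lemma B_matrix_index:
  assumes "i < length vs" "j < length vs"
  shows "B_matrix G vs $$ (i, j) = distance_laplacian G vs $$ (i, j) + real (max_dist G vs j)"
  using assms distance_laplacian_carrier[of G vs]
  by (simp add: B_matrix_def scalar_prod_def mat_of_cols_def mat_of_rows_def
      all_ones_vec_def max_dist_vec_def)

text \<open>
  The column index \<open>j\<close> selects the eccentricity, so the distance is written as one from \<open>j\<close>: the
  entry measures how far \<open>i\<close> is from being a farthest vertex from \<open>j\<close>.
\<close>

lemma B_matrix_off_diagonal: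
  assumes "pair_graph G" "i < length vs" "j < length vs" "i \<noteq> j"
  shows "B_matrix G vs $$ (i, j) =
    real (max_dist G vs j) - real (graph_dist G (vs ! j) (vs ! i))"
  using assms by (simp add: B_matrix_index distance_laplacian_index graph_dist_commute)

lemma B_matrix_nonneg:
  assumes "connected_labelled_graph G vs" "i < length vs" "j < length vs"
  shows "B_matrix G vs $$ (i, j) \<ge> 0"
proof (cases "i = j")
  case True
  have set: "set vs = pverts G" using assms(1) by (simp add: connected_labelled_graph_def)
  have "graph_dist G (vs ! i) (vs ! i) \<le> transmission G (vs ! i)"
    using assms(2) unfolding transmission_def set[symmetric] by (intro member_le_sum) auto
  then show ?thesis using assms True by (simp add: B_matrix_index distance_laplacian_index)
next
  case False
  then show ?thesis
    using assms graph_dist_le_max_dist[of j vs i G]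
    by (simp add: B_matrix_off_diagonal connected_labelled_graph_def)
qed

text \<open>
  The list of real roots is not empty, because the all-ones vector is an eigenvector for 0; so its
  first entry is one of its members. Being an eigenvalue is all that the bound uses.
\<close>

lemma dl_eigenvalue_1_eigenvalue:
  assumes "connected_labelled_graph G vs" and n: "length vs \<ge> 2"
  shows "eigenvalue (distance_laplacian G vs) (dl_eigenvalue G vs 1)"
proof -
  let ?L = "distance_laplacian G vs" and ?n = "length vs"
  note L = distance_laplacian_carrier[of G vs]
  have "?L *\<^sub>v all_ones_vec ?n = 0 \<cdot>\<^sub>v all_ones_vec ?n"
  proof (rule eq_vecI)
    fix i assume "i < dim_vec (0 \<cdot>\<^sub>v all_ones_vec ?n)"
    then have i: "i < ?n" by (simp add: all_ones_vec_def)
    have "(?L *\<^sub>v all_ones_vec ?n) $ i = (\<Sum>j<?n. ?L $$ (i, j))"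
      using L i by (auto simp: scalar_prod_def all_ones_vec_def lessThan_atLeast0 intro!: sum.cong)
    also have "\<dots> = 0"
      using assms i by (intro distance_laplacian_row_sum) (auto simp: connected_labelled_graph_def)
    finally show "(?L *\<^sub>v all_ones_vec ?n) $ i = (0 \<cdot>\<^sub>v all_ones_vec ?n) $ i"
      using i by (simp add: all_ones_vec_def)
  qed (use L in \<open>auto simp: all_ones_vec_def\<close>)
  moreover have "all_ones_vec ?n \<noteq> 0\<^sub>v ?n"
  proof
    assume "all_ones_vec ?n = 0\<^sub>v ?n"
    then have "all_ones_vec ?n $ 0 = 0\<^sub>v ?n $ 0" by simp
    moreover have "vs \<noteq> []" using n by auto
    ultimately show False by (simp add: all_ones_vec_def)
  qed
  ultimately have "eigenvalue ?L 0"
    using L unfolding eigenvalue_def eigenvector_def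
    by (intro exI[of _ "all_ones_vec ?n"]) (auto simp: all_ones_vec_def)
  then have root: "poly (char_poly ?L) 0 = 0" by (simp add: eigenvalue_root_char_poly[OF L])
  have nz: "char_poly ?L \<noteq> 0" using degree_monic_char_poly[OF L] by auto
  have set: "set (dl_eigenvalues G vs) = {k. poly (char_poly ?L) k = 0}"
    by (simp add: dl_eigenvalues_def nz)
  with root have "dl_eigenvalues G vs \<noteq> []" by force
  then have "dl_eigenvalue G vs 1 \<in> set (dl_eigenvalues G vs)"
    by (simp add: dl_eigenvalue_def)
  then show ?thesis by (simp add: set eigenvalue_root_char_poly[OF L])
qed

text \<open>
  The eigenvalue 0, which the shift argument excludes, is harmless: eccentricities are positive, so
  it lies strictly below their sum.
\<close>

lemma dl_eigenvalue_1_bound: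
  assumes G: "connected_labelled_graph G vs" and n: "length vs \<ge> 2"
  shows "dl_eigenvalue G vs 1 \<le> (\<Sum>i<length vs. real (max_dist G vs i))"
    and "dl_eigenvalue G vs 1 = (\<Sum>i<length vs. real (max_dist G vs i)) \<Longrightarrow>
      \<exists>S T. zero_block (B_matrix G vs) S \<and> zero_block (B_matrix G vs) T \<and> S \<inter> T = {}"
proof -
  let ?k = "dl_eigenvalue G vs 1" and ?P = "\<Sum>i<length vs. real (max_dist G vs i)"
  have P: "?P > 0" using n max_dist_pos[OF G n] by (intro sum_pos) (auto simp: lessThan_empty_iff)
  have bound: "?k \<le> ?P \<and> (?k = ?P \<longrightarrow>
      (\<exists>S T. zero_block (B_matrix G vs) S \<and> zero_block (B_matrix G vs) T \<and> S \<inter> T = {}))"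
    if "?k \<noteq> 0"
    using nonzero_eigenvalue_le_sum_of_shift[OF distance_laplacian_carrier B_matrix_carrier
        distance_laplacian_row_sum B_matrix_index B_matrix_nonneg[OF G]
        dl_eigenvalue_1_eigenvalue[OF G n] that] G
    by (simp add: connected_labelled_graph_def)
  show "?k \<le> ?P" using bound P by (cases "?k = 0") auto
  assume "?k = ?P"
  with bound P show "\<exists>S T. zero_block (B_matrix G vs) S \<and> zero_block (B_matrix G vs) T \<and> S \<inter> T = {}"
    by simp
qed

lemma reducible_if_disjoint_zero_blocks:
  assumes A: "A \<in> carrier_mat n n" "n \<ge> 2"
    and S: "zero_block A S" and T: "zero_block A T" and "S \<inter> T = {}"
  shows "reducible_mat A"
proof -
  have "S \<subset> {0..<dim_row A}" using S T \<open>S \<inter> T = {}\<close> unfolding zero_block_def by blast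
  then show ?thesis
    using A S unfolding reducible_mat_def zero_block_def
    by (intro conjI exI[of _ S]) auto
qed

section \<open>The wheel on five vertices\<close>

text \<open>
  The hub is 0 and the rim is the cycle 1, 2, 3, 4: two rim vertices are adjacent exactly if their
  parities differ.
\<close>

definition wheel :: "nat pair_pre_digraph" where
  "wheel = \<lparr>pverts = {0..<5},
     parcs = {(i, j). i < 5 \<and> j < 5 \<and> i \<noteq> j \<and> (i = 0 \<or> j = 0 \<or> odd (i + j))}\<rparr>"

lemma wheel_connected: "connected_labelled_graph wheel [0..<5]"
proof -
  have "finite (parcs wheel)"
    by (rule finite_subset[of _ "{0..<5} \<times> {0..<5}"]) (auto simp: wheel_def)
  then have g: "pair_graph wheel"
    by unfold_locales (auto simp: wheel_def symmetric_def sym_def add.commute)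
  interpret pair_graph wheel by fact
  have verts: "pverts wheel = {0..<5}" by (simp add: wheel_def)
  have hub: "0 \<rightarrow>\<^sup>*\<^bsub>with_proj wheel\<^esub> i" if "i < 5" for i
  proof (cases "i = 0")
    case True
    have "0 \<in> pverts wheel" by (simp add: verts)
    then show ?thesis using True by simp
  next
    case False
    then show ?thesis using that by (intro reachable_adjI) (simp add: wheel_def)
  qed
  have "i \<rightarrow>\<^sup>*\<^bsub>with_proj wheel\<^esub> j" if "i < 5" "j < 5" for i j
    using symmetric_reachable[OF pair_sym_arcs hub[OF that(1)]] hub[OF that(2)]
    by (rule reachable_trans)
  then have "i \<rightarrow>\<^sup>*\<^bsub>with_proj (mk_symmetric (with_proj wheel))\<^esub> j" if "i < 5" "j < 5" for i j
    using that by (intro reachable_mk_symmetricI)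
  then have "Digraph_Component.connected (with_proj wheel)"
    unfolding Digraph_Component.connected_def strongly_connected_def by (simp add: verts)
  then show ?thesis using g by (simp add: connected_labelled_graph_def verts)
qed

lemma wheel_dist_eq_1_iff:
  assumes "i < 5" "j < 5" "i \<noteq> j"
  shows "graph_dist wheel i j = 1 \<longleftrightarrow> i = 0 \<or> j = 0 \<or> odd (i + j)"
  using graph_dist_eq_1_iff[of wheel i j] wheel_connected assms
  by (auto simp: connected_labelled_graph_def wheel_def)

lemma wheel_B_matrix_off_diagonal:
  assumes "i < 5" "j < 5" "i \<noteq> j"
  shows "B_matrix wheel [0..<5] $$ (i, j) =
    real (max_dist wheel [0..<5] j) - real (graph_dist wheel j i)"
  using assms wheel_connected
  by (simp add: B_matrix_off_diagonal connected_labelled_graph_def)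

text \<open>
  The hub is adjacent to all other vertices, so its eccentricity is 1 and every rim vertex attains
  it: the column of the hub is zero off the diagonal.
\<close>

lemma wheel_reducible: "reducible_mat (B_matrix wheel [0..<5])"
proof -
  have "max_dist wheel [0..<5] 0 = 1"
  proof -
    have "{graph_dist wheel ([0..<5] ! 0) ([0..<5] ! j) |j. j < length [0..<5] \<and> j \<noteq> 0} = {1}"
      using wheel_dist_eq_1_iff[of 0] by (auto intro!: exI[of _ 1])
    then show ?thesis by (simp add: max_dist_def)
  qed
  then have "B_matrix wheel [0..<5] $$ (i, 0) = 0" if "i \<in> {1..<5}" for i
    using that wheel_dist_eq_1_iff[of 0 i] by (simp add: wheel_B_matrix_off_diagonal)
  then have "\<forall>i\<in>{1..<5}. \<forall>j\<in>{0..<5} - {1..<5}. B_matrix wheel [0..<5] $$ (i, j) = 0"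
    by (auto simp: not_le less_Suc_eq)
  moreover have "{1..<5} \<subset> {0..<5::nat}" by force
  ultimately show ?thesis
    using B_matrix_carrier[of wheel "[0..<5]"] unfolding reducible_mat_def
    by (intro conjI exI[of _ "{1..<5}"]) auto
qed

text \<open>
  A neighbour \<open>i\<close> of a rim vertex \<open>j\<close> is not farthest from \<open>j\<close>, since the opposite rim vertex is at
  distance at least 2.
\<close>

lemma wheel_B_matrix_pos:
  assumes "i < 5" "j < 5" "i \<noteq> j" "j \<noteq> 0" "i = 0 \<or> odd (i + j)"
  shows "B_matrix wheel [0..<5] $$ (i, j) > 0"
proof -
  \<comment> \<open>\<open>a\<close> is the rim vertex opposite to \<open>j\<close>.\<close>
  define a where "a = (if j \<le> 2 then j + 2 else j - 2)"
  have a: "a < 5" "a \<noteq> j" "a \<noteq> 0" "even (j + a)" using assms by (auto simp: a_def)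
  have conn: "pair_graph wheel" "Digraph_Component.connected (with_proj wheel)" "pverts wheel = {0..<5}"
    using wheel_connected by (auto simp: connected_labelled_graph_def wheel_def)
  have "graph_dist wheel j a > 0"
    using graph_dist_pos[OF conn(1,2), of j a] a assms conn(3) by simp
  moreover have "graph_dist wheel j a \<noteq> 1" using wheel_dist_eq_1_iff[of j a] a assms by simp
  moreover have "graph_dist wheel j a \<le> max_dist wheel [0..<5] j"
    using graph_dist_le_max_dist[of j "[0..<5]" a wheel] a assms by simp
  moreover have "graph_dist wheel j i = 1"
    using wheel_dist_eq_1_iff[of j i] assms by (auto simp: add.commute)
  ultimately show ?thesis using assms by (simp add: wheel_B_matrix_off_diagonal)
qed

text \<open>
  A zero block contains each rim vertex \<open>j\<close> adjacent to one of its members \<open>i\<close>, because the entry at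
  \<open>(i, j)\<close> is positive. Starting anywhere, such steps reach the whole rim; the vertex 1 is enough to
  show that two zero blocks meet.
\<close>

lemma wheel_zero_block_rim:
  assumes S: "zero_block (B_matrix wheel [0..<5]) S"
  shows "1 \<in> S"
proof -
  have dim: "dim_row (B_matrix wheel [0..<5]) = 5" using B_matrix_carrier[of wheel "[0..<5]"] by simp
  have step: "j \<in> S" if "i \<in> S" "j < 5" "i \<noteq> j" "j \<noteq> 0" "i = 0 \<or> odd (i + j)" for i j
  proof (rule ccontr)
    assume "j \<notin> S"
    with S that have "B_matrix wheel [0..<5] $$ (i, j) = 0" "i < 5"
      by (auto simp: zero_block_def dim)
    with wheel_B_matrix_pos[of i j] that show False by simp
  qed
  obtain i where i: "i \<in> S" using S unfolding zero_block_def by blast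
  then have "i < 5" using S unfolding zero_block_def dim by auto
  then consider "i = 0" | "i = 1" | "i = 2" | "i = 3" | "i = 4" by linarith
  then show "1 \<in> S"
  proof cases
    case 4
    then have "2 \<in> S" using step[of 3 2] i by simp
    then show ?thesis using step[of 2 1] by simp
  qed (use i step[of i 1] in auto)
qed

theorem theorem8:
  shows "(\<forall>(G :: 'a pair_pre_digraph) vs. connected_labelled_graph G vs \<and> length vs \<ge> 2 \<longrightarrow>
            dl_eigenvalue G vs 1 \<le> (\<Sum>i<length vs. real (max_dist G vs i)) \<and>
            (dl_eigenvalue G vs 1 = (\<Sum>i<length vs. real (max_dist G vs i)) \<longrightarrow>
               reducible_mat (B_matrix G vs)) \<and>
            (irreducible_mat (B_matrix G vs) \<longrightarrow>
               dl_eigenvalue G vs 1 < (\<Sum>i<length vs. real (max_dist G vs i)))) \<and>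
         (\<exists>(G :: nat pair_pre_digraph) vs. connected_labelled_graph G vs \<and> length vs \<ge> 2 \<and>
            reducible_mat (B_matrix G vs) \<and>
            dl_eigenvalue G vs 1 < (\<Sum>i<length vs. real (max_dist G vs i)))"
proof (intro conjI allI impI)
  fix G :: "'a pair_pre_digraph" and vs
  assume "connected_labelled_graph G vs \<and> length vs \<ge> 2"
  then have G: "connected_labelled_graph G vs" and n: "length vs \<ge> 2" by auto
  let ?k = "dl_eigenvalue G vs 1" and ?P = "\<Sum>i<length vs. real (max_dist G vs i)"
  show le: "?k \<le> ?P" by (rule dl_eigenvalue_1_bound(1)[OF G n])
  show red: "reducible_mat (B_matrix G vs)" if eq: "?k = ?P"
  proof -
    obtain S T where "zero_block (B_matrix G vs) S" "zero_block (B_matrix G vs) T" "S \<inter> T = {}"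
      using dl_eigenvalue_1_bound(2)[OF G n eq] by auto
    then show ?thesis by (rule reducible_if_disjoint_zero_blocks[OF B_matrix_carrier n])
  qed
  show "?k < ?P" if "irreducible_mat (B_matrix G vs)"
    using le red that by (auto simp: irreducible_mat_def less_le)
next
  have n: "length [0..<5] \<ge> 2" by simp
  have "dl_eigenvalue wheel [0..<5] 1 \<noteq> (\<Sum>i<length [0..<5]. real (max_dist wheel [0..<5] i))"
    using dl_eigenvalue_1_bound(2)[OF wheel_connected n] wheel_zero_block_rim by blast
  then have less: "dl_eigenvalue wheel [0..<5] 1 < (\<Sum>i<length [0..<5]. real (max_dist wheel [0..<5] i))"
    using dl_eigenvalue_1_bound(1)[OF wheel_connected n] by linarith
  show "\<exists>(G :: nat pair_pre_digraph) vs. connected_labelled_graph G vs \<and> length vs \<ge> 2 \<and>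
      reducible_mat (B_matrix G vs) \<and>
      dl_eigenvalue G vs 1 < (\<Sum>i<length vs. real (max_dist G vs i))"
    by (intro exI conjI) (rule wheel_connected n wheel_reducible less)+
qed

end
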